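(* For every integer $n\ge 2$, $\psi_{sq}(K_{1,n})=n$.
   Context: $K_{1,n}$ is the star with one center and $n$ leaves. $N_G[v]$ denotes the closed neighborhood of $v$ in a finite simple graph $G$. A sub-quorum coloring of $G$ with $k$ colors is an onto partial map $f:V(G)\dashrightarrow\{1,\ldots,k\}$ such that, with $S=\operatorname{dom}(f)$, every $v\in S$ satisfies $|\{u\in N_G[v]\cap S: f(u)=f(v)\}|\ge\frac12|N_G[v]\cap S|$; $\psi_{sq}(G)$ is the maximum such $k$. *)

theory Defs
  imports Complex_Main "Graph_Theory.Graph_Theory"
begin

text \<open>
  A finite simple graph is a \<^term>\<open>G\<close> with \<^term>\<open>graph G\<close>: a finite, loop-free, symmetric digraph
  without parallel arcs.  The star with \<open>n\<close> leaves is the complete bipartite graph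
  \<open>K\<^bsub>1,n\<^esub>\<close> of the library, which is a predicate, so that it covers every copy of the star
  regardless of the naming of its vertices.
\<close>

text \<open>Only meant for symmetric \<open>G\<close>; otherwise these are closed out-neighborhoods.\<close>

definition closed_neighborhood :: "('a, 'b) pre_digraph \<Rightarrow> 'a \<Rightarrow> 'a set" where
  "closed_neighborhood G v = insert v {u. v \<rightarrow>\<^bsub>G\<^esub> u}"

definition sub_quorum_coloring :: "('a, 'b) pre_digraph \<Rightarrow> nat \<Rightarrow> ('a \<rightharpoonup> nat) \<Rightarrow> bool" where
  "sub_quorum_coloring G k f \<longleftrightarrow>
     dom f \<subseteq> verts G \<and> ran f = {1..k} \<and>
     (\<forall>v \<in> dom f.
        real (card {u \<in> closed_neighborhood G v \<inter> dom f. f u = f v})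
          \<ge> 1 / 2 * real (card (closed_neighborhood G v \<inter> dom f)))"

text \<open>
  The empty map is a coloring with \<open>k = 0\<close>, and finitely many vertices bound \<open>k\<close>, so for a finite
  graph the maximum below is taken over a finite nonempty set; see the lemmas that follow.
\<close>

definition sub_quorum_number :: "('a, 'b) pre_digraph \<Rightarrow> nat" (\<open>\<psi>\<^sub>s\<^sub>q\<close>) where
  "\<psi>\<^sub>s\<^sub>q G = Max {k. \<exists>f. sub_quorum_coloring G k f}"

lemma sub_quorum_coloring_empty: "sub_quorum_coloring G 0 Map.empty"
  by (simp add: sub_quorum_coloring_def)

lemma sub_quorum_coloring_le_card:
  assumes "finite (verts G)" "sub_quorum_coloring G k f"
  shows "k \<le> card (verts G)"
proof -
  have sub: "dom f \<subseteq> verts G" and ran: "ran f = {1..k}"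
    using assms(2) by (auto simp: sub_quorum_coloring_def)
  have fin: "finite (dom f)"
    using sub assms(1) by (rule finite_subset)
  have "ran f = (\<lambda>v. the (f v)) ` dom f"
    by (force simp: ran_def dom_def)
  then have "card (ran f) \<le> card (dom f)"
    using card_image_le[OF fin] by simp
  also have "\<dots> \<le> card (verts G)"
    using assms(1) sub by (rule card_mono)
  finally show ?thesis by (simp add: ran)
qed

lemma finite_sub_quorum_colors:
  assumes "finite (verts G)"
  shows "finite {k. \<exists>f. sub_quorum_coloring G k f}"
  by (rule finite_subset[of _ "{..card (verts G)}"])
     (auto dest: sub_quorum_coloring_le_card[OF assms])

text \<open>Stars of every size exist, so the predicate \<open>K\<^bsub>1,n\<^esub>\<close> is satisfiable.\<close>

lemma star_exists: "\<exists>G :: nat pair_pre_digraph. K\<^bsub>1,n\<^esub> (with_proj G)"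
  by (rule exI[of _ "\<lparr>pverts = {0..n}, parcs = {0} \<times> {1..n} \<union> {1..n} \<times> {0}\<rparr>"],
      unfold complete_bipartite_digraph_pair_def,
      intro conjI exI[of _ "{0}"] exI[of _ "{1..n}"]) auto

end

theory Submission
  imports Defs
begin

text \<open>
  Two observations about an arbitrary finite graph pin down the value on a star.  Vertices left
  uncolored are ignored by the quorum condition, so coloring just an independent set, each vertex
  with its own color, is always legal: every vertex then sees nothing but itself.  The leaves of the
  star thus give \<open>n\<close> colors (\<open>independent_set_le_sub_quorum_number\<close>).

  Conversely, the star has only \<open>n + 1\<close> vertices, so more than \<open>n\<close> colors would mean that all
  vertices are colored, with pairwise distinct colors.  Then a vertex finds its color only at itself,
  and the quorum condition bounds its closed neighborhood by two vertices
  (\<open>closed_neighborhood_le_2_if_rainbow\<close>).  The center, which has at least two leaves as neighbors,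
  violates this bound.
\<close>

text \<open>
  Color \<open>I\<close> injectively and nothing else: the colored part of the closed neighborhood of \<open>v\<close> is
  then \<open>{v}\<close>.  A loop would not enlarge it, so independence only concerns distinct vertices.
\<close>

lemma independent_set_le_sub_quorum_number:
  assumes fin: "finite (verts G)" and sub: "I \<subseteq> verts G"
    and indep: "\<And>u v. u \<in> I \<Longrightarrow> v \<in> I \<Longrightarrow> u \<noteq> v \<Longrightarrow> \<not> u \<rightarrow>\<^bsub>G\<^esub> v"
  shows "card I \<le> \<psi>\<^sub>s\<^sub>q G"
proof -
  have "finite I"
    using sub fin by (rule finite_subset)
  then obtain h where h: "bij_betw h I {1..card I}"
    using finite_same_card_bij[of I "{1..card I}"] by auto
  define f where "f = (\<lambda>v. if v \<in> I then Some (h v) else None)"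
  have dom_f: "dom f = I"
    by (auto simp: f_def dom_def)
  have "ran f = h ` I"
    by (auto simp: f_def ran_def)
  then have ran_f: "ran f = {1..card I}"
    using h by (simp add: bij_betw_def)
  have quorum: "real (card {u \<in> closed_neighborhood G v \<inter> dom f. f u = f v})
      \<ge> 1 / 2 * real (card (closed_neighborhood G v \<inter> dom f))" if "v \<in> dom f" for v
  proof -
    have "closed_neighborhood G v \<inter> dom f = {v}"
      using that indep by (auto simp: dom_f closed_neighborhood_def)
    moreover from this have "{u \<in> closed_neighborhood G v \<inter> dom f. f u = f v} = {v}"
      by auto
    ultimately show ?thesis
      by simp
  qed
  have "sub_quorum_coloring G (card I) f"
    using sub quorum by (simp add: sub_quorum_coloring_def dom_f ran_f)
  then show ?thesis
    unfolding sub_quorum_number_def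
    by (intro Max_ge finite_sub_quorum_colors[OF fin]) blast
qed

text \<open>
  As many colors as vertices leave no room for a repeated color or an uncolored vertex, so the color
  class of \<open>v\<close> is the singleton \<open>{v}\<close>, which has to make up half of its closed neighborhood.
\<close>

lemma closed_neighborhood_le_2_if_rainbow:
  assumes fin: "finite (verts G)" and col: "sub_quorum_coloring G (card (verts G)) f"
    and v: "v \<in> verts G"
  shows "card (closed_neighborhood G v \<inter> verts G) \<le> 2"
proof -
  have sub: "dom f \<subseteq> verts G" and ran: "ran f = {1..card (verts G)}"
    using col by (auto simp: sub_quorum_coloring_def)
  have fin_dom: "finite (dom f)"
    using sub fin by (rule finite_subset)
  have "ran f = (\<lambda>u. the (f u)) ` dom f"
    by (force simp: ran_def dom_def)
  then have image: "card ((\<lambda>u. the (f u)) ` dom f) = card (verts G)"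
    using ran by (metis card_atLeastAtMost diff_Suc_1)
  then have "card (verts G) \<le> card (dom f)"
    using card_image_le[OF fin_dom, of "\<lambda>u. the (f u)"] by simp
  then have total: "dom f = verts G"
    using sub fin by (meson card_seteq)
  have inj: "inj_on (\<lambda>u. the (f u)) (dom f)"
    using fin_dom image total by (intro eq_card_imp_inj_on) simp_all
  have "{u \<in> closed_neighborhood G v \<inter> dom f. f u = f v} = {v}"
    using v total inj_onD[OF inj] by (auto simp: closed_neighborhood_def)
  moreover have "real (card {u \<in> closed_neighborhood G v \<inter> dom f. f u = f v})
      \<ge> 1 / 2 * real (card (closed_neighborhood G v \<inter> dom f))"
    using col v total unfolding sub_quorum_coloring_def by blast
  ultimately show ?thesis
    by (simp add: total)
qed

theorem proposition5p10:
  fixes G :: "('a, 'b) pre_digraph" and n :: nat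
  assumes "n \<ge> 2" and "K\<^bsub>1,n\<^esub> G"
  shows "\<psi>\<^sub>s\<^sub>q G = n"
proof (rule antisym)
  from assms(2) obtain U L where verts: "verts G = U \<union> L" and disj: "U \<inter> L = {}"
    and U: "card U = 1" and L: "card L = n" and arcs: "arcs_ends G = U \<times> L \<union> L \<times> U"
    unfolding complete_bipartite_digraph_def by blast
  from U obtain c where c: "U = {c}"
    by (auto simp: card_1_singleton_iff)
  have "finite L"
    using L assms(1) by (intro card_ge_0_finite) simp
  then have fin: "finite (verts G)" and card_verts: "card (verts G) = n + 1"
    using verts disj c L by auto
  show "n \<le> \<psi>\<^sub>s\<^sub>q G"
    using independent_set_le_sub_quorum_number[OF fin, of L] verts disj arcs L by auto
  have "k \<le> n" if col: "sub_quorum_coloring G k f" for k f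
  proof (rule ccontr)
    assume "\<not> k \<le> n"
    then have "k = card (verts G)"
      using sub_quorum_coloring_le_card[OF fin col] card_verts by simp
    then have "card (closed_neighborhood G c \<inter> verts G) \<le> 2"
      using closed_neighborhood_le_2_if_rainbow[OF fin] col verts c by blast
    moreover have "closed_neighborhood G c \<inter> verts G = verts G"
      using verts arcs c by (auto simp: closed_neighborhood_def)
    ultimately show False
      using card_verts assms(1) by simp
  qed
  then show "\<psi>\<^sub>s\<^sub>q G \<le> n"
    unfolding sub_quorum_number_def
    using finite_sub_quorum_colors[OF fin] sub_quorum_coloring_empty[of G]
    by (subst Max_le_iff) auto
qed

end
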